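(* Let $A_1,\ldots,A_d\in\mathbb{S}^n$ be linearly independent, $\mathcal{L}=\mathrm{span}_{\mathbb{R}}(A_1,\ldots,A_d)$, and $\pi:\mathbb{S}^n\to\mathbb{R}^d$, $\pi(X)=(\langle A_1,X\rangle,\ldots,\langle A_d,X\rangle)$. Let $C\in\mathbb{S}^n$, and for $0<\epsilon\leq\infty$ let $\mathcal{L}_\epsilon=\mathcal{L}-\frac{1}{\epsilon}C$ (with $\mathcal{L}_\infty=\mathcal{L}$). For $b\in\pi(\mathbb{S}^n_+)$, the intersection of the spectrahedron $\pi^{-1}(b)=\{X\in\mathbb{S}^n_+:\pi(X)=b\}$ with the Gibbs manifold $\mathrm{GM}(\mathcal{L}_\epsilon)$ consists of a single point $X^*_\epsilon$. This point is the optimal solution to the regularized semidefinite program $$\text{Minimize}\quad\langle C,X\rangle-\epsilon\cdot h(X)\quad\text{subject to}\quad X\in\mathbb{S}^n_+\text{ and }\pi(X)=b.$$ For $\epsilon=\infty$, it is the unique maximizer of the von Neumann entropy $h$ on the spectrahedron $\pi^{-1}(b)$.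
   Context: $\mathbb{S}^n$ is the space of real symmetric $n\times n$ matrices with inner product $\langle X,Y\rangle=\mathrm{trace}(XY)$; $\mathbb{S}^n_+$ is the closed cone of positive semidefinite matrices. For an affine subspace $\mathcal{M}\subset\mathbb{S}^n$, the Gibbs manifold is $\mathrm{GM}(\mathcal{M})=\exp(\mathcal{M})$, the image under the matrix exponential. The von Neumann entropy is $h:\mathbb{S}^n_+\to\mathbb{R}$, $h(X)=\mathrm{trace}(X-X\cdot\log(X))=\sum_{i=1}^n(\lambda_i-\lambda_i\log\lambda_i)$, where $\lambda_1,\ldots,\lambda_n$ are the eigenvalues of $X$ and $0\log0=0$. The regularized semidefinite program is considered for finite $\epsilon>0$; in the case $\epsilon=\infty$ the dependency on $C$ disappears.
   Formalization: The formal theorem takes b in the interior of π(S^n_+), not just in π(S^n_+): for boundary b (e.g. d=1, A_1=I, C=0, b=0, where π^{-1}(b)={0}) the intersection with the Gibbs manifold is empty, since exponentials are positive definite. *)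

theory Defs
  imports "HOL-Analysis.Analysis" "HOL-Computational_Algebra.Polynomial"
begin

definition sym_mats :: "(real^'n^'n) set" where
  "sym_mats = {X. transpose X = X}"

definition psd_cone :: "(real^'n^'n) set" where
  "psd_cone = {X \<in> sym_mats. \<forall>v. 0 \<le> v \<bullet> (X *v v)}"

definition tr_inner :: "real^'n^'n \<Rightarrow> real^'n^'n \<Rightarrow> real" where
  "tr_inner X Y = trace (X ** Y)"

definition proj :: "('d \<Rightarrow> real^'n^'n) \<Rightarrow> real^'n^'n \<Rightarrow> real^'d" where
  "proj A X = (\<chi> k. tr_inner (A k) X)"

definition spectrahedron :: "('d \<Rightarrow> real^'n^'n) \<Rightarrow> real^'d \<Rightarrow> (real^'n^'n) set" where
  "spectrahedron A b = {X \<in> psd_cone. proj A X = b}"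

(* Powers are with respect to the matrix product **; the library's * and ^ on
   real^'n^'n act entrywise. *)
definition mexp :: "real^'n^'n \<Rightarrow> real^'n^'n" where
  "mexp X = (\<Sum>k. (1 / fact k) *\<^sub>R (((**) X ^^ k) (mat 1)))"

(* Exponentials of symmetric matrices are positive definite. So for M \<subseteq> sym_mats this set meets the
   spectrahedron of b only if b is the image under proj of a positive definite matrix, i.e.
   (for independent A k) only if b lies in the interior of proj A ` psd_cone. *)
definition gibbs_manifold :: "(real^'n^'n) set \<Rightarrow> (real^'n^'n) set" where
  "gibbs_manifold M = mexp ` M"

(* For \<epsilon> = \<infinity> the extended-real quotient 1 / \<epsilon> is 0, so this is the span of the A k. *)
definition shifted_span :: "('d \<Rightarrow> real^'n^'n) \<Rightarrow> real^'n^'n \<Rightarrow> ereal \<Rightarrow> (real^'n^'n) set" where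
  "shifted_span A C \<epsilon> = (\<lambda>M. M - real_of_ereal (1 / \<epsilon>) *\<^sub>R C) ` span (range A)"

definition charpoly :: "real^'n^'n \<Rightarrow> real poly" where
  "charpoly X = det (\<chi> i j. (if i = j then [:0, 1:] else 0) - [:X $ i $ j:])"

(* The sum runs over the eigenvalues with multiplicity. A zero eigenvalue contributes
   0 * ln 0 = 0, which is the convention 0 log 0 = 0. *)
definition vn_entropy :: "real^'n^'n \<Rightarrow> real" where
  "vn_entropy X = (\<Sum>x\<in>#proots (charpoly X). x - x * ln x)"

end

theory Submission
  imports Defs
begin

text \<open>Klein's inequality states that
  \<open>h(Y) \<le> trace (exp M) - \<langle>M, Y\<rangle>\<close> for positive semidefinite \<open>Y\<close> and symmetric \<open>M\<close>, with equality
  only at \<open>Y = exp M\<close>. If \<open>M\<close> lies in the shifted span, then on the spectrahedron the term \<open>\<langle>M, Y\<rangle>\<close>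
  is constant up to \<open>- \<langle>C, Y\<rangle> / \<epsilon>\<close>, so every Gibbs point of the spectrahedron is the strict optimum
  of the regularized program; in particular there is at most one. A Gibbs point is found by minimising the
  dual function \<open>y \<mapsto> trace (exp (\<Sum> y\<^sub>k A\<^sub>k - C / \<epsilon>)) - \<langle>b, y\<rangle>\<close>: its stationarity condition says that
  the exponential lies in the fibre over \<open>b\<close>.\<close>

section \<open>Eigenbases of symmetric matrices\<close>

lemma sym_mats_inner: "X \<in> sym_mats \<Longrightarrow> v \<bullet> (X *v w) = (X *v v) \<bullet> w"
  by (metis (mono_tags, lifting) dot_lmul_matrix mem_Collect_eq sym_mats_def transpose_matrix_vector)

text \<open>A maximiser \<open>v\<close> of the quadratic form on the unit sphere of
  \<open>S\<close> is an eigenvector. The form \<open>q\<close> is nonnegative on \<open>S\<close>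
  and vanishes at \<open>v\<close>, so a small move from \<open>v\<close> against the residual
  \<open>r\<close> would make it negative unless \<open>r = 0\<close>.\<close>

lemma sym_mats_eigenvector_subspace:
  fixes X :: "real^'n^'n"
  assumes X: "X \<in> sym_mats" and S: "subspace S" "S \<noteq> {0}"
    and inv: "\<And>v. v \<in> S \<Longrightarrow> X *v v \<in> S"
  obtains v l where "v \<in> S" "norm v = 1" "X *v v = l *\<^sub>R v"
proof -
  define K where "K = sphere 0 1 \<inter> S"
  obtain w where w: "w \<in> S" "w \<noteq> 0"
    using S subspace_0 by blast
  have "w /\<^sub>R norm w \<in> K"
    using w S by (simp add: K_def subspace_scale)
  moreover have "compact K"
    unfolding K_def by (intro compact_Int_closed closed_subspace S) auto
  moreover have "continuous_on K (\<lambda>v. v \<bullet> (X *v v))"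
    by (intro continuous_intros)
  ultimately obtain v where v: "v \<in> K" and max: "\<And>w. w \<in> K \<Longrightarrow> w \<bullet> (X *v w) \<le> v \<bullet> (X *v v)"
    by (metis continuous_attains_sup empty_iff)
  have vS: "v \<in> S" and v1: "v \<bullet> v = 1" "norm v = 1"
    using v by (auto simp: K_def dot_square_norm)
  define l where "l = v \<bullet> (X *v v)"
  define q where "q w = l * (w \<bullet> w) - w \<bullet> (X *v w)" for w
  have q: "0 \<le> q w" if "w \<in> S" for w
  proof (cases "w = 0")
    case False
    have "w /\<^sub>R norm w \<in> K"
      using False that S by (simp add: K_def subspace_scale)
    from max[OF this] have "(w \<bullet> (X *v w)) / (norm w)\<^sup>2 \<le> l"
      by (simp add: l_def matrix_vector_mult_scaleR power2_eq_square divide_inverse mult_ac)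
    then show ?thesis
      using False by (simp add: q_def dot_square_norm field_simps)
  qed (simp add: q_def)
  define r where "r = l *\<^sub>R v - X *v v"
  have rS: "r \<in> S"
    unfolding r_def using S vS inv by (simp add: subspace_diff subspace_scale)
  have q_line: "q (v - s *\<^sub>R r) = s\<^sup>2 * q r - 2 * s * (r \<bullet> r)" for s
  proof -
    have "v \<bullet> (X *v r) = (X *v v) \<bullet> r" "r \<bullet> (X *v v) = (X *v v) \<bullet> r"
      by (rule sym_mats_inner[OF X], rule inner_commute)
    then have "q (v - s *\<^sub>R r) = s\<^sup>2 * q r - 2 * s * (l * (v \<bullet> r) - (X *v v) \<bullet> r)"
      by (simp add: q_def v1 matrix_vector_mult_diff_distrib matrix_vector_mult_scaleR
          inner_diff_left inner_diff_right inner_commute[of r v] power2_eq_square algebra_simps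
          flip: l_def)
    moreover have "l * (v \<bullet> r) - (X *v v) \<bullet> r = r \<bullet> r"
      by (subst (3) r_def) (simp add: inner_diff_left)
    ultimately show ?thesis by simp
  qed
  \<comment> \<open>A step short enough that the quadratic term of \<open>q_line\<close> is at most
    half the linear one; the \<open>+ 1\<close> keeps the denominator positive when
    \<open>q r = 0\<close>.\<close>
  define s where "s = (r \<bullet> r) / (q r + 1)"
  have "0 \<le> q (v - s *\<^sub>R r)"
    using q S vS rS by (simp add: subspace_diff subspace_scale)
  then have "2 * s * (r \<bullet> r) \<le> s\<^sup>2 * q r"
    by (simp add: q_line)
  moreover have "s\<^sup>2 * q r \<le> s * (r \<bullet> r)"
  proof -
    have "0 \<le> s"
      using q[OF rS] by (simp add: s_def)
    then have "s * q r \<le> s * (q r + 1)"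
      by (simp add: mult_left_mono)
    also have "\<dots> = r \<bullet> r"
      using q[OF rS] by (simp add: s_def)
    finally show ?thesis
      using \<open>0 \<le> s\<close> by (simp add: power2_eq_square mult.assoc mult_left_mono)
  qed
  ultimately have "s * (r \<bullet> r) \<le> 0" by simp
  then have "(r \<bullet> r)\<^sup>2 \<le> 0"
    using q[OF rS] by (simp add: s_def power2_eq_square divide_le_0_iff)
  then have "r = 0" by simp
  then have "X *v v = l *\<^sub>R v"
    by (simp add: r_def)
  with vS v1 show thesis using that by blast
qed

text \<open>Induction on the dimension: split off one eigenvector; by symmetry of \<open>X\<close>
  its orthogonal complement in \<open>S\<close> is again invariant.\<close>

lemma sym_mats_eigenvector_basis:
  fixes X :: "real^'n^'n"
  assumes X: "X \<in> sym_mats" and S: "subspace S" and inv: "\<And>v. v \<in> S \<Longrightarrow> X *v v \<in> S"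
  shows "\<exists>B \<subseteq> S. finite B \<and> card B = dim S \<and> pairwise orthogonal B \<and>
           (\<forall>v\<in>B. norm v = 1 \<and> (\<exists>l. X *v v = l *\<^sub>R v))"
  using S inv
proof (induction "dim S" arbitrary: S)
  case 0
  then show ?case
    by (intro exI[of _ "{}"]) auto
next
  case (Suc n)
  have "S \<noteq> {0}"
    using Suc.hyps(2) by auto
  then obtain v l where v: "v \<in> S" "norm v = 1" "X *v v = l *\<^sub>R v"
    using sym_mats_eigenvector_subspace[OF X Suc.prems(1)] Suc.prems(2) by blast
  define T where "T = {y \<in> S. \<forall>x \<in> span {v}. orthogonal x y}"
  have T: "T = {y \<in> S. v \<bullet> y = 0}"
    by (auto simp: T_def orthogonal_def span_singleton)
  have "dim T + dim (span {v}) = dim S"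
    unfolding T_def using Suc.prems v by (intro dim_subspace_orthogonal_to_vectors)
      (auto simp: span_minimal)
  moreover have "dim (span {v}) = 1"
    using v by (auto simp: dim_span)
  ultimately have "n = dim T"
    using Suc.hyps by simp
  moreover have "subspace T"
    using Suc.prems(1) by (auto simp: T subspace_def inner_add_right)
  moreover have "X *v w \<in> T" if "w \<in> T" for w
    using that Suc.prems(2) by (simp add: T sym_mats_inner[OF X] v)
  ultimately obtain B where B: "B \<subseteq> T" "finite B" "card B = dim T" "pairwise orthogonal B"
    "\<forall>v\<in>B. norm v = 1 \<and> (\<exists>l. X *v v = l *\<^sub>R v)"
    using Suc.hyps(1) by metis
  have "v \<notin> B"
    using B(1) v by (auto simp: T)
  then have "card (insert v B) = dim S"
    using B Suc.hyps \<open>n = dim T\<close> by simp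
  moreover have "pairwise orthogonal (insert v B)"
    using B by (auto simp: pairwise_insert T orthogonal_def inner_commute subset_iff)
  moreover have "insert v B \<subseteq> S"
    using B v by (auto simp: T)
  ultimately show ?case
    using B v by (intro exI[of _ "insert v B"]) auto
qed

text \<open>The index type is that of the coordinates, so an orthonormal family already has full
  size and spans the space.\<close>

definition orthonormal_basis :: "('n \<Rightarrow> real^'n) \<Rightarrow> bool" where
  "orthonormal_basis u \<longleftrightarrow> (\<forall>i j. u i \<bullet> u j = (if i = j then 1 else 0))"

text \<open>A spectral decomposition as a relation; indexing \<open>l\<close> by \<open>'n\<close>
  lists eigenvalues with multiplicity.\<close>

definition eigenbasis :: "real^'n^'n \<Rightarrow> ('n \<Rightarrow> real^'n) \<Rightarrow> ('n \<Rightarrow> real) \<Rightarrow> bool" where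
  "eigenbasis X u l \<longleftrightarrow> orthonormal_basis u \<and> (\<forall>i. X *v u i = l i *\<^sub>R u i)"

theorem sym_mats_eigenbasis:
  fixes X :: "real^'n^'n"
  assumes "X \<in> sym_mats"
  obtains u l where "eigenbasis X u l"
proof -
  obtain B where B: "finite B" "card B = CARD('n)" "pairwise orthogonal B"
    "\<And>v. v \<in> B \<Longrightarrow> norm v = 1" "\<And>v. v \<in> B \<Longrightarrow> \<exists>l. X *v v = l *\<^sub>R v"
    using sym_mats_eigenvector_basis[OF assms subspace_UNIV] by auto
  obtain u where u: "bij_betw u (UNIV :: 'n set) B"
    using B by (metis finite_same_card_bij finite_class.finite_UNIV)
  then have uB: "u i \<in> B" for i
    by (auto simp: bij_betw_def)
  have "u i \<bullet> u j = (if i = j then 1 else 0)" for i j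
  proof (cases "i = j")
    case False
    then have "u i \<noteq> u j"
      using u by (auto simp: bij_betw_def inj_def)
    then show ?thesis
      using False B(3) uB by (auto simp: pairwise_def orthogonal_def)
  qed (use B(4)[OF uB] in \<open>auto simp: dot_square_norm\<close>)
  moreover obtain l where "\<And>i. X *v u i = l i *\<^sub>R u i"
    using B(5)[OF uB] by metis
  ultimately have "eigenbasis X u l"
    by (simp add: eigenbasis_def orthonormal_basis_def)
  then show thesis by (rule that)
qed

section \<open>Expansions in orthonormal bases and eigenbases\<close>

lemma orthonormal_basis_expansion:
  fixes u :: "'n::finite \<Rightarrow> real^'n"
  assumes "orthonormal_basis u"
  shows "(\<Sum>i\<in>UNIV. (x \<bullet> u i) *\<^sub>R u i) = x"
proof -
  have u: "u i \<bullet> u j = (if i = j then 1 else 0)" for i j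
    using assms by (auto simp: orthonormal_basis_def)
  have inj: "inj u"
    by (rule injI) (metis u zero_neq_one)
  have orth: "pairwise orthogonal (range u)"
    by (auto simp: pairwise_def orthogonal_def u)
  moreover have "0 \<notin> range u"
    by (metis inner_zero_left rangeE u zero_neq_one)
  ultimately have "independent (range u)"
    by (rule pairwise_orthogonal_independent)
  then have "span (range u) = UNIV"
    using card_image[OF inj] by (simp add: dim_eq_full[symmetric] dim_eq_card_independent)
  then have "(\<Sum>v\<in>range u. (x \<bullet> v) *\<^sub>R v) = x"
    using orth by (intro orthonormal_basis_expand) (auto simp: norm_eq_sqrt_inner u)
  then show ?thesis
    by (simp add: sum.reindex[OF inj])
qed

lemma orthonormal_basis_parseval:
  fixes u :: "'n::finite \<Rightarrow> real^'n"
  assumes "orthonormal_basis u"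
  shows "(\<Sum>i\<in>UNIV. (x \<bullet> u i) * (y \<bullet> u i)) = x \<bullet> y"
proof -
  have "x \<bullet> y = x \<bullet> (\<Sum>i\<in>UNIV. (y \<bullet> u i) *\<^sub>R u i)"
    by (simp add: orthonormal_basis_expansion[OF assms])
  then show ?thesis
    by (simp add: inner_sum_right mult.commute)
qed

lemma eigenbasis_apply:
  assumes "eigenbasis X u l"
  shows "X *v x = (\<Sum>i\<in>UNIV. (l i * (x \<bullet> u i)) *\<^sub>R u i)"
proof -
  have "X *v x = X *v (\<Sum>i\<in>UNIV. (x \<bullet> u i) *\<^sub>R u i)"
    using assms by (simp add: orthonormal_basis_expansion eigenbasis_def)
  also have "\<dots> = (\<Sum>i\<in>UNIV. (l i * (x \<bullet> u i)) *\<^sub>R u i)"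
    using assms by (simp add: eigenbasis_def linear_sum[OF matrix_vector_mul_linear]
        matrix_vector_mult_scaleR mult.commute)
  finally show ?thesis .
qed

lemma eigenbasis_inner:
  assumes "eigenbasis X u l"
  shows "y \<bullet> (X *v x) = (\<Sum>i\<in>UNIV. l i * ((x \<bullet> u i) * (y \<bullet> u i)))"
  by (simp add: eigenbasis_apply[OF assms] inner_sum_right mult_ac)

text \<open>The expansion of the bilinear form is symmetric in its two arguments. Symmetry of
  \<open>mexp X\<close> is obtained this way from its eigenbasis.\<close>

lemma eigenbasis_sym_mats:
  assumes "eigenbasis X u l"
  shows "X \<in> sym_mats"
proof -
  have "transpose X *v x = X *v x" for x
  proof (rule vector_eq_rdot[THEN iffD1], rule allI)
    fix y
    have "(transpose X *v x) \<bullet> y = x \<bullet> (X *v y)"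
      by (metis dot_lmul_matrix transpose_matrix_vector)
    also have "\<dots> = (X *v x) \<bullet> y"
      by (simp add: inner_commute[of "X *v x"] eigenbasis_inner[OF assms] mult.commute)
    finally show "(transpose X *v x) \<bullet> y = (X *v x) \<bullet> y" .
  qed
  then show ?thesis
    by (simp add: sym_mats_def matrix_eq)
qed

lemma eigenbasis_psd_cone:
  assumes "eigenbasis X u l" "\<And>i. 0 \<le> l i"
  shows "X \<in> psd_cone"
  using assms by (auto simp: psd_cone_def eigenbasis_inner eigenbasis_sym_mats intro!: sum_nonneg)

lemma psd_cone_eigenvalue_nonneg:
  assumes "X \<in> psd_cone" "eigenbasis X u l"
  shows "0 \<le> l i"
proof -
  have "0 \<le> u i \<bullet> (X *v u i)" "u i \<bullet> u i = 1" "X *v u i = l i *\<^sub>R u i"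
    using assms unfolding psd_cone_def eigenbasis_def orthonormal_basis_def by (blast, simp_all)
  then show ?thesis
    by simp
qed

lemma eigenbasis_eqI:
  assumes "eigenbasis X u l" "\<And>i. Y *v u i = l i *\<^sub>R u i"
  shows "Y = X"
  using eigenbasis_apply[of X u l] eigenbasis_apply[of Y u l] assms
  by (simp add: matrix_eq eigenbasis_def)

text \<open>Writing both factors in coordinates and swapping the sums leaves Parseval's identity for
  a standard basis vector and a row of \<open>X\<close>.\<close>

lemma trace_orthonormal_basis:
  fixes X :: "real^'n^'n"
  assumes "orthonormal_basis u"
  shows "trace X = (\<Sum>i\<in>UNIV. u i \<bullet> (X *v u i))"
proof -
  have "(\<Sum>i\<in>UNIV. u i \<bullet> (X *v u i)) = (\<Sum>i\<in>UNIV. \<Sum>a\<in>UNIV. (u i $ a) * ((X *v u i) $ a))"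
    by (simp add: inner_vec_def)
  also have "\<dots> = (\<Sum>i\<in>UNIV. \<Sum>a\<in>UNIV. (axis a 1 \<bullet> u i) * ((X $ a) \<bullet> u i))"
    by (simp add: inner_axis' matrix_vector_mul_component)
  also have "\<dots> = (\<Sum>a\<in>UNIV. axis a 1 \<bullet> (X $ a))"
    by (subst sum.swap) (simp add: orthonormal_basis_parseval[OF assms])
  also have "\<dots> = trace X"
    by (simp add: trace_def inner_axis')
  finally show ?thesis by simp
qed

section \<open>Characteristic polynomial and entropy in terms of eigenvalues\<close>

lemma poly_charpoly: "poly (charpoly X) x = det (mat x - X)"
  unfolding charpoly_def det_def
  by (auto simp: poly_sum poly_prod mat_def intro!: sum.cong prod.cong)

text \<open>The matrix \<open>Q\<close> with columns \<open>u i\<close> intertwines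
  \<open>mat x - X\<close> with the diagonal matrix \<open>D\<close>; as \<open>det Q\<close> is
  nonzero, it cancels.\<close>

lemma det_similar_diagonal:
  assumes "eigenbasis X u l"
  shows "det (mat x - X) = (\<Prod>i\<in>UNIV. x - l i)"
proof -
  define Q where "Q = (\<chi> a i. u i $ a)"
  define D where "D = (\<chi> i j. if i = j then x - l i else 0)"
  have Xu: "(\<Sum>k\<in>UNIV. X $ a $ k * u i $ k) = l i * u i $ a" for a i
    using assms by (simp add: eigenbasis_def matrix_vector_mult_def vec_eq_iff)
  have "transpose Q ** Q = mat 1"
    using assms by (auto simp: vec_eq_iff Q_def matrix_matrix_mult_def transpose_def mat_def
        eigenbasis_def orthonormal_basis_def inner_vec_def)
  then have Q: "det Q \<noteq> 0"
    by (metis det_I det_mul mult_zero_right zero_neq_one)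
  have "(mat x - X) ** Q = Q ** D"
    by (auto simp: vec_eq_iff matrix_matrix_mult_def Q_def D_def mat_def left_diff_distrib
        right_diff_distrib sum_subtractf Xu if_distrib[of "\<lambda>t. t * _"]
        if_distrib[of "\<lambda>t. _ * t"] cong: if_cong)
  then have "det (mat x - X) * det Q = det Q * det D"
    by (metis det_mul)
  then have "det (mat x - X) = det D"
    using Q by simp
  also have "det D = (\<Prod>i\<in>UNIV. x - l i)"
    by (subst det_diagonal) (auto simp: D_def)
  finally show ?thesis .
qed

lemma charpoly_eigenbasis:
  assumes "eigenbasis X u l"
  shows "charpoly X = (\<Prod>i\<in>UNIV. [:- l i, 1:])"
proof -
  have "poly (charpoly X) = poly (\<Prod>i\<in>UNIV. [:- l i, 1:])"
    by (rule ext) (simp add: poly_charpoly det_similar_diagonal[OF assms] poly_prod)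
  then show ?thesis
    by (simp only: poly_eq_poly_eq_iff)
qed

lemma sum_mset_sum_singleton: "(\<Sum>x\<in>#(\<Sum>i\<in>I. {#l i#}). g x) = (\<Sum>i\<in>I. g (l i))"
  by (induction I rule: infinite_finite_induct) auto

text \<open>The characteristic polynomial splits into the factors \<open>[:- l i, 1:]\<close>, so
  its multiset of roots is the family \<open>l\<close>.\<close>

lemma vn_entropy_eigenbasis:
  assumes "eigenbasis X u l"
  shows "vn_entropy X = (\<Sum>i\<in>UNIV. l i - l i * ln (l i))"
  by (simp add: vn_entropy_def charpoly_eigenbasis[OF assms] proots_prod sum_mset_sum_singleton)

section \<open>The matrix exponential\<close>

lemma bounded_bilinear_matrix_mult:
  "bounded_bilinear ((**) :: real^'n^'n \<Rightarrow> real^'n^'n \<Rightarrow> real^'n^'n)"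
proof -
  have "linear (\<lambda>Y. X ** Y)" for X :: "real^'n^'n"
    by (rule linearI) (simp_all add: matrix_add_ldistrib matrix_scalar_ac scalar_matrix_assoc)
  moreover have "linear (\<lambda>X. X ** Y)" for Y :: "real^'n^'n"
    by (rule linearI)
      (simp_all add: matrix_matrix_mult_def vec_eq_iff distrib_right sum.distrib
        sum_distrib_left mult.assoc)
  ultimately show ?thesis
    unfolding bilinear_conv_bounded_bilinear[symmetric] bilinear_def by blast
qed

definition mpow :: "real^'n^'n \<Rightarrow> nat \<Rightarrow> real^'n^'n" where
  "mpow X k = ((**) X ^^ k) (mat 1)"

lemma mpow_simps: "mpow X 0 = mat 1" "mpow X (Suc k) = X ** mpow X k"
  by (simp_all add: mpow_def)

lemma continuous_on_mpow: "continuous_on S (\<lambda>X. mpow X k)"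
  by (induction k)
    (auto simp: mpow_simps intro!: bounded_bilinear.continuous_on[OF bounded_bilinear_matrix_mult]
      continuous_on_const continuous_on_id)

text \<open>Submultiplicativity of the norm up to a constant \<open>K\<close> gives an exponential
  majorant on the whole ball. It serves both convergence of the series and, by the Weierstrass test,
  continuity.\<close>

lemma mexp_majorant:
  obtains m where "summable m"
    "\<And>(X :: real^'n^'n) k. norm X \<le> r \<Longrightarrow> norm ((1 / fact k) *\<^sub>R mpow X k) \<le> m k"
proof -
  have "\<exists>K\<ge>0. \<forall>(X :: real^'n^'n) (Y :: real^'n^'n). norm (X ** Y) \<le> norm X * norm Y * K"
    by (rule bounded_bilinear.nonneg_bounded[OF bounded_bilinear_matrix_mult])
  then obtain K where K: "0 \<le> K" "\<And>(X :: real^'n^'n) (Y :: real^'n^'n). norm (X ** Y) \<le> norm X * norm Y * K"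
    by blast
  let ?c = "norm (mat 1 :: real^'n^'n)"
  have bound: "norm (mpow X k) \<le> ?c * (r * K) ^ k" if X: "norm X \<le> r" for X :: "real^'n^'n" and k
  proof (induction k)
    case (Suc k)
    have "norm (mpow X (Suc k)) \<le> norm X * norm (mpow X k) * K"
      by (simp add: mpow_simps K)
    also have "\<dots> \<le> r * (?c * (r * K) ^ k) * K"
      using Suc X K(1) order_trans[OF norm_ge_zero X] by (intro mult_mono) auto
    finally show ?case by (simp add: mult_ac)
  qed (simp add: mpow_simps)
  show thesis
  proof
    show "summable (\<lambda>k. ?c * (inverse (fact k) * (r * K) ^ k))"
      by (intro summable_mult summable_exp)
    show "norm ((1 / fact k) *\<^sub>R mpow X k) \<le> ?c * (inverse (fact k) * (r * K) ^ k)"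
      if "norm X \<le> r" for X :: "real^'n^'n" and k
      using bound[OF that, of k] by (simp add: divide_simps mult_ac)
  qed
qed

lemma mexp_sums: "(\<lambda>k. (1 / fact k) *\<^sub>R mpow X k) sums mexp X"
proof -
  obtain m where "summable m" "\<And>k. norm ((1 / fact k) *\<^sub>R mpow X k) \<le> m k"
    using mexp_majorant[of "norm X"] by (metis order_refl)
  then have "summable (\<lambda>k. (1 / fact k) *\<^sub>R mpow X k)"
    by (rule summable_comparison_test'[of m 0])
  then show ?thesis
    by (simp add: mexp_def mpow_def summable_sums)
qed

lemma continuous_on_mexp: "continuous_on S (mexp :: real^'n^'n \<Rightarrow> _)"
proof -
  have "isCont mexp X" for X :: "real^'n^'n"
  proof -
    define U where "U = cball (0 :: real^'n^'n) (norm X + 1)"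
    obtain m where m: "summable m"
      "\<And>(Y :: real^'n^'n) k. norm Y \<le> norm X + 1 \<Longrightarrow> norm ((1 / fact k) *\<^sub>R mpow Y k) \<le> m k"
      using mexp_majorant[of "norm X + 1"] by metis
    have "uniform_limit U (\<lambda>n Y. \<Sum>k<n. (1 / fact k) *\<^sub>R mpow Y k)
        (\<lambda>Y. \<Sum>k. (1 / fact k) *\<^sub>R mpow Y k) sequentially"
      using m by (intro Weierstrass_m_test) (auto simp: U_def)
    moreover have "(\<Sum>k. (1 / fact k) *\<^sub>R mpow Y k) = mexp Y" for Y :: "real^'n^'n"
      using mexp_sums sums_unique by metis
    ultimately have "continuous_on U mexp"
      by (intro uniform_limit_theorem[where F = sequentially
            and f = "\<lambda>n Y. \<Sum>k<n. (1 / fact k) *\<^sub>R mpow Y k"])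
        (auto intro!: continuous_intros continuous_on_mpow always_eventually)
    moreover have "X \<in> interior U"
      by (simp add: U_def)
    ultimately show ?thesis
      using continuous_on_interior by blast
  qed
  then show ?thesis
    by (simp add: continuous_at_imp_continuous_on)
qed

text \<open>Evaluation at \<open>u i\<close> is bounded linear, so it passes through the series and
  leaves the scalar exponential series of \<open>l i\<close>.\<close>

lemma eigenbasis_mexp:
  fixes X :: "real^'n^'n"
  assumes "eigenbasis X u l"
  shows "eigenbasis (mexp X) u (\<lambda>i. exp (l i))"
proof -
  have "mpow X k *v u i = l i ^ k *\<^sub>R u i" for k i
  proof (induction k)
    case (Suc k)
    then have "mpow X (Suc k) *v u i = l i ^ k *\<^sub>R (X *v u i)"
      by (simp add: mpow_simps matrix_vector_mult_scaleR flip: matrix_vector_mul_assoc)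
    then show ?case
      using assms by (simp add: eigenbasis_def mult.commute)
  qed (simp add: mpow_simps)
  then have term_eq: "(1 / fact k) *\<^sub>R mpow X k *v u i = (l i ^ k /\<^sub>R fact k) *\<^sub>R u i" for k i
    by (simp add: divide_inverse flip: scaleR_matrix_vector_assoc)
  have "mexp X *v u i = exp (l i) *\<^sub>R u i" for i
  proof (rule sums_unique2)
    have "linear (\<lambda>Y :: real^'n^'n. Y *v u i)"
      by (intro linearI) (simp_all add: matrix_vector_mult_add_rdistrib scaleR_matrix_vector_assoc)
    then have "bounded_linear (\<lambda>Y :: real^'n^'n. Y *v u i)"
      by (rule linear_conv_bounded_linear[THEN iffD1])
    then show "(\<lambda>k. (1 / fact k) *\<^sub>R mpow X k *v u i) sums (mexp X *v u i)"
      by (rule bounded_linear.sums[OF _ mexp_sums])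
    show "(\<lambda>k. (1 / fact k) *\<^sub>R mpow X k *v u i) sums (exp (l i) *\<^sub>R u i)"
      unfolding term_eq by (intro sums_scaleR_left exp_converges)
  qed
  then show ?thesis
    using assms by (simp add: eigenbasis_def)
qed

section \<open>Klein's inequality\<close>

lemma tr_inner_linear_left:
  "tr_inner (X + Y) Z = tr_inner X Z + tr_inner Y Z"
  "tr_inner (r *\<^sub>R X) Z = r * tr_inner X Z"
  "tr_inner (- X) Z = - tr_inner X Z"
  "tr_inner (X - Y) Z = tr_inner X Z - tr_inner Y Z"
  "tr_inner 0 Z = 0"
  by (simp_all add: tr_inner_def trace_def matrix_matrix_mult_def sum.distrib sum_subtractf
      sum_negf sum_distrib_left distrib_right left_diff_distrib mult.assoc)

lemma tr_inner_sum_left: "tr_inner (\<Sum>i\<in>I. f i) Z = (\<Sum>i\<in>I. tr_inner (f i) Z)"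
  by (induction I rule: infinite_finite_induct) (simp_all add: tr_inner_linear_left)

lemma continuous_on_tr_inner [continuous_intros]:
  "continuous_on S f \<Longrightarrow> continuous_on S (\<lambda>x. tr_inner X (f x))"
  unfolding tr_inner_def trace_def matrix_matrix_mult_def
  by (simp, intro continuous_intros)

text \<open>Cyclicity of the trace lets \<open>X\<close> act on its own eigenvectors first, so
  \<open>Y\<close> can be arbitrary.\<close>

lemma tr_inner_eigenbasis:
  fixes X Y :: "real^'n^'n"
  assumes "eigenbasis X u l"
  shows "tr_inner X Y = (\<Sum>i\<in>UNIV. l i * (u i \<bullet> (Y *v u i)))"
proof -
  have "tr_inner X Y = trace (Y ** X)"
    unfolding tr_inner_def by (rule trace_mul_sym)
  also have "\<dots> = (\<Sum>i\<in>UNIV. u i \<bullet> (Y *v (X *v u i)))"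
    using trace_orthonormal_basis[of u "Y ** X"] assms
    by (simp add: eigenbasis_def flip: matrix_vector_mul_assoc)
  also have "\<dots> = (\<Sum>i\<in>UNIV. l i * (u i \<bullet> (Y *v u i)))"
    using assms by (simp add: eigenbasis_def matrix_vector_mult_scaleR)
  finally show ?thesis .
qed

lemma trace_eigenbasis:
  assumes "eigenbasis X u l"
  shows "trace X = (\<Sum>i\<in>UNIV. l i)"
proof -
  have "orthonormal_basis u" "\<And>i. X *v u i = l i *\<^sub>R u i"
    using assms by (simp_all add: eigenbasis_def)
  then show ?thesis
    by (simp add: trace_orthonormal_basis orthonormal_basis_def)
qed

text \<open>The equality case of Klein's inequality: \<open>M\<close> and \<open>mexp M\<close>
  share an eigenbasis, and \<open>ln\<close> undoes \<open>exp\<close> on the eigenvalues.\<close>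

lemma vn_entropy_mexp:
  fixes M :: "real^'n^'n"
  assumes "M \<in> sym_mats"
  shows "vn_entropy (mexp M) = trace (mexp M) - tr_inner M (mexp M)"
proof -
  obtain u m where M: "eigenbasis M u m"
    using sym_mats_eigenbasis[OF assms] .
  note E = eigenbasis_mexp[OF M]
  have "u i \<bullet> (mexp M *v u i) = exp (m i)" for i
    using E unfolding eigenbasis_def orthonormal_basis_def by simp
  then show ?thesis
    by (simp add: vn_entropy_eigenbasis[OF E] trace_eigenbasis[OF E] tr_inner_eigenbasis[OF M]
        sum_subtractf mult.commute)
qed

lemma mexp_psd_cone:
  fixes M :: "real^'n^'n"
  assumes "M \<in> sym_mats"
  shows "mexp M \<in> psd_cone"
proof -
  obtain u m where "eigenbasis M u m"
    using sym_mats_eigenbasis[OF assms] .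
  then show ?thesis
    by (intro eigenbasis_psd_cone[OF eigenbasis_mexp]) auto
qed

text \<open>The Fenchel-Young inequality for \<open>exp\<close>. For \<open>l > 0\<close> it is
  \<open>ln x \<le> x - 1\<close> at \<open>x = exp m / l\<close>, with equality only at
  \<open>x = 1\<close>; for \<open>l = 0\<close> it reads \<open>0 \<le> exp m\<close>, which is
  never an equality.\<close>

lemma entropy_young:
  fixes l m :: real
  assumes "0 \<le> l"
  shows "l - l * ln l \<le> exp m - l * m"
    and "l - l * ln l = exp m - l * m \<Longrightarrow> l = exp m"
proof -
  have "l - l * ln l \<le> exp m - l * m \<and> (l - l * ln l = exp m - l * m \<longrightarrow> l = exp m)"
  proof (cases "l = 0")
    case False
    with assms have l: "0 < l" by simp
    define x where "x = exp m / l"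
    have x: "0 < x" "exp m = l * x" "m = ln x + ln l"
      using l by (simp_all add: x_def ln_div)
    have "ln x \<le> x - 1" "ln x = x - 1 \<Longrightarrow> x = 1"
      using x(1) ln_le_minus_one ln_eq_minus_one by blast+
    moreover have "exp m - l * m - (l - l * ln l) = l * (x - 1 - ln x)"
      unfolding x(2) by (subst x(3)) (simp add: algebra_simps)
    ultimately show ?thesis
      using l x(2) by (smt (verit) mult_cancel_left1 mult_nonneg_nonneg no_zero_divisors)
  qed simp
  then show "l - l * ln l \<le> exp m - l * m"
    and "l - l * ln l = exp m - l * m \<Longrightarrow> l = exp m" by blast+
qed

text \<open>Expanding all three terms in eigenbases of \<open>Y\<close> and \<open>M\<close> reduces the claim to the scalar
  inequality, weighted by the squared inner products of the eigenvectors.\<close>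

theorem klein_inequality:
  fixes Y M :: "real^'n^'n"
  assumes Y: "Y \<in> psd_cone" and M: "M \<in> sym_mats"
  shows "vn_entropy Y \<le> trace (mexp M) - tr_inner M Y"
    and "vn_entropy Y = trace (mexp M) - tr_inner M Y \<Longrightarrow> Y = mexp M"
proof -
  obtain u l where u: "eigenbasis Y u l"
    using Y sym_mats_eigenbasis by (auto simp: psd_cone_def)
  obtain v m where v: "eigenbasis M v m"
    using sym_mats_eigenbasis[OF M] .
  have l: "0 \<le> l i" for i
    using psd_cone_eigenvalue_nonneg[OF Y u] .
  have ob: "orthonormal_basis u" "orthonormal_basis v"
    using u v by (simp_all add: eigenbasis_def)
  \<comment> \<open>By Parseval in either basis the weights are doubly stochastic, so each sum over
    one spectrum becomes a double sum.\<close>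
  define w where "w i j = (u i \<bullet> v j)\<^sup>2" for i j
  have w1: "(\<Sum>j\<in>UNIV. w i j) = 1" for i
    using orthonormal_basis_parseval[OF ob(2), of "u i" "u i"] ob(1)
    by (simp add: w_def power2_eq_square orthonormal_basis_def)
  have w2: "(\<Sum>i\<in>UNIV. w i j) = 1" for j
    using orthonormal_basis_parseval[OF ob(1), of "v j" "v j"] ob(2)
    by (simp add: w_def power2_eq_square orthonormal_basis_def inner_commute)
  have "vn_entropy Y = (\<Sum>i\<in>UNIV. (\<Sum>j\<in>UNIV. w i j) * (l i - l i * ln (l i)))"
    by (simp add: vn_entropy_eigenbasis[OF u] w1)
  then have h: "vn_entropy Y = (\<Sum>j\<in>UNIV. \<Sum>i\<in>UNIV. w i j * (l i - l i * ln (l i)))"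
    by (subst sum.swap) (simp only: sum_distrib_right)
  have "trace (mexp M) = (\<Sum>j\<in>UNIV. (\<Sum>i\<in>UNIV. w i j) * exp (m j))"
    by (simp add: trace_eigenbasis[OF eigenbasis_mexp[OF v]] w2)
  then have t: "trace (mexp M) = (\<Sum>j\<in>UNIV. \<Sum>i\<in>UNIV. w i j * exp (m j))"
    by (simp only: sum_distrib_right)
  have p: "tr_inner M Y = (\<Sum>j\<in>UNIV. \<Sum>i\<in>UNIV. w i j * (l i * m j))"
    by (simp add: tr_inner_eigenbasis[OF v] eigenbasis_inner[OF u] w_def power2_eq_square
        inner_commute sum_distrib_left mult_ac)
  define gap where "gap i j = exp (m j) - l i * m j - (l i - l i * ln (l i))" for i j
  have gap: "0 \<le> w i j * gap i j" for i j
    using entropy_young(1)[OF l] by (simp add: w_def gap_def)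
  have eq: "trace (mexp M) - tr_inner M Y - vn_entropy Y = (\<Sum>j\<in>UNIV. \<Sum>i\<in>UNIV. w i j * gap i j)"
    unfolding h t p sum_subtractf[symmetric] by (simp add: gap_def right_diff_distrib)
  have "0 \<le> (\<Sum>j\<in>UNIV. \<Sum>i\<in>UNIV. w i j * gap i j)"
    by (intro sum_nonneg gap)
  then show "vn_entropy Y \<le> trace (mexp M) - tr_inner M Y"
    using eq by simp
  show "Y = mexp M" if "vn_entropy Y = trace (mexp M) - tr_inner M Y"
  proof (rule eigenbasis_eqI[OF eigenbasis_mexp[OF v]])
    fix j
    have "(\<Sum>j\<in>UNIV. \<Sum>i\<in>UNIV. w i j * gap i j) = 0"
      using eq that by simp
    then have "w i j * gap i j = 0" for i
      using gap by (simp add: sum_nonneg_eq_0_iff sum_nonneg)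
    \<comment> \<open>An eigenvector \<open>u i\<close> not orthogonal to \<open>v j\<close> has
      positive weight, so its gap vanishes and its eigenvalue is \<open>exp (m j)\<close>. Hence
      \<open>Y\<close> scales \<open>v j\<close> by this number.\<close>
    then have "v j \<bullet> u i = 0 \<or> l i = exp (m j)" for i
      using entropy_young(2)[OF l, of i "m j"]
      by (metis eq_iff_diff_eq_0 gap_def inner_commute mult_eq_0_iff power_eq_0_iff w_def)
    then have "l i * (v j \<bullet> u i) = exp (m j) * (v j \<bullet> u i)" for i
      by (metis mult_zero_right)
    then have "Y *v v j = (\<Sum>i\<in>UNIV. exp (m j) *\<^sub>R (v j \<bullet> u i) *\<^sub>R u i)"
      by (simp only: eigenbasis_apply[OF u] scaleR_scaleR)
    also have "\<dots> = exp (m j) *\<^sub>R v j"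
      by (simp only: scaleR_sum_right[symmetric] orthonormal_basis_expansion[OF ob(1)])
    finally show "Y *v v j = exp (m j) *\<^sub>R v j" .
  qed
qed

section \<open>Gibbs points\<close>

text \<open>Coordinates on the affine space \<open>P + span (range A)\<close>, so that the dual
  function lives on \<open>real^'d\<close>.\<close>

definition pencil :: "('d \<Rightarrow> real^'n^'n) \<Rightarrow> real^'n^'n \<Rightarrow> real^'d \<Rightarrow> real^'n^'n" where
  "pencil A P y = (\<Sum>k\<in>UNIV. y $ k *\<^sub>R A k) + P"

lemma subspace_sym_mats: "subspace sym_mats"
  by (auto simp: subspace_def sym_mats_def transpose_def vec_eq_iff)

lemma pencil_sym_mats:
  assumes "\<And>k. A k \<in> sym_mats" "P \<in> sym_mats"
  shows "pencil A P y \<in> sym_mats"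
  unfolding pencil_def using assms subspace_sym_mats
  by (intro subspace_add subspace_sum subspace_scale) auto

lemma tr_inner_pencil: "tr_inner (pencil A P y) X = y \<bullet> proj A X + tr_inner P X"
  by (simp add: pencil_def tr_inner_linear_left tr_inner_sum_left inner_vec_def proj_def)

lemma pencil_add_axis: "pencil A P (y + t *\<^sub>R axis k 1) = pencil A P y + t *\<^sub>R A k"
proof -
  have "(\<Sum>j\<in>UNIV. (t * axis k 1 $ j) *\<^sub>R A j) = (\<Sum>j\<in>UNIV. if j = k then t *\<^sub>R A k else 0)"
    by (intro sum.cong) (auto simp: axis_def)
  then show ?thesis
    by (simp add: pencil_def scaleR_left_distrib sum.distrib)
qed

text \<open>The sign condition makes \<open>f\<close> nonnegative to the right of 0 and nonpositive
  to the left; both one-sided limits are \<open>f 0\<close>.\<close>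

lemma continuous_eq_0_if_sign:
  fixes f :: "real \<Rightarrow> real"
  assumes "isCont f 0" "\<And>t. 0 \<le> t * f t"
  shows "f 0 = 0"
proof (rule antisym)
  have "(\<lambda>n. inverse (real (Suc n))) \<longlonglongrightarrow> 0"
    by (rule LIMSEQ_inverse_real_of_nat)
  moreover from this have "(\<lambda>n. - inverse (real (Suc n))) \<longlonglongrightarrow> 0"
    using tendsto_minus by fastforce
  ultimately have "(\<lambda>n. f (inverse (real (Suc n)))) \<longlonglongrightarrow> f 0"
    "(\<lambda>n. f (- inverse (real (Suc n)))) \<longlonglongrightarrow> f 0"
    using isCont_tendsto_compose[OF assms(1)] by blast+
  moreover have "0 \<le> f t" if "0 < t" for t
    using assms(2)[of t] that by (simp add: zero_le_mult_iff)
  moreover have "f t \<le> 0" if "t < 0" for t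
    using assms(2)[of t] that by (simp add: zero_le_mult_iff)
  ultimately show "0 \<le> f 0" "f 0 \<le> 0"
    by (auto intro: LIMSEQ_le_const LIMSEQ_le_const2)
qed

text \<open>Minimises the dual function \<open>g\<close>. By Klein's inequality, matrices in the fibres over
  \<open>b \<plusminus> \<delta> e\<^sub>k\<close> bound it below by \<open>\<delta> \<bar>y\<^sub>k\<bar>\<close> up to a constant, so it is coercive; at
  a minimiser the same inequality yields stationarity without differentiating the exponential.\<close>

lemma mexp_pencil_meets_spectrahedron:
  fixes A :: "'d::finite \<Rightarrow> real^'n^'n"
  assumes A: "\<And>k. A k \<in> sym_mats" and P: "P \<in> sym_mats"
    and b: "b \<in> interior (proj A ` psd_cone)"
  obtains y where "mexp (pencil A P y) \<in> spectrahedron A b"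
proof -
  note sym = pencil_sym_mats[of A P, OF A P]
  define g where "g y = trace (mexp (pencil A P y)) - b \<bullet> y" for y
  have cont_pencil: "continuous_on UNIV (pencil A P)"
    unfolding pencil_def by (intro continuous_intros)
  have cont_mexp: "continuous_on UNIV (\<lambda>y. mexp (pencil A P y))"
    using continuous_on_compose2[OF continuous_on_mexp cont_pencil] by blast
  have cont: "continuous_on UNIV g"
    unfolding g_def trace_def by (intro continuous_intros cont_mexp)
  define S where "S = {y. g y \<le> g 0}"
  \<comment> \<open>The interior assumption makes the fibres over
    \<open>b + s *\<^sub>R axis k 1\<close> nonempty for both signs \<open>s = d\<close> and
    \<open>s = - d\<close>.\<close>
  obtain d where d: "0 < d" "cball b d \<subseteq> proj A ` psd_cone"
    using b by (meson mem_interior_cball)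
  have fibre: "\<exists>c. \<forall>y. s * (y $ k) \<le> g y + c" if s: "\<bar>s\<bar> = d" for s k
  proof -
    have "b + s *\<^sub>R axis k 1 \<in> cball b d"
      using s by (simp add: dist_norm)
    then obtain Y where Y: "Y \<in> psd_cone" "proj A Y = b + s *\<^sub>R axis k 1"
      using d by (metis imageE subsetD)
    have "s * (y $ k) \<le> g y - tr_inner P Y - vn_entropy Y" for y
      using klein_inequality(1)[OF Y(1) sym, of y]
      by (simp add: g_def tr_inner_pencil Y(2) inner_add_right inner_axis inner_commute)
    then show ?thesis
      by (intro exI[of _ "- tr_inner P Y - vn_entropy Y"]) (simp add: algebra_simps)
  qed
  have "\<exists>B. \<forall>y\<in>S. \<bar>y $ k\<bar> \<le> B" for k
  proof -
    obtain c1 c2 where "\<And>y. d * (y $ k) \<le> g y + c1" "\<And>y. - d * (y $ k) \<le> g y + c2"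
      using fibre[of d k] fibre[of "- d" k] d(1) by auto
    then have "d * \<bar>y $ k\<bar> \<le> g 0 + max c1 c2" if "y \<in> S" for y
      using that unfolding S_def by (smt (verit) mem_Collect_eq mult_minus_left mult_minus_right)
    then have "\<bar>y $ k\<bar> \<le> (g 0 + max c1 c2) / d" if "y \<in> S" for y
      using that d(1) by (simp add: pos_le_divide_eq mult.commute)
    then show ?thesis by blast
  qed
  then obtain B where B: "\<And>y k. y \<in> S \<Longrightarrow> \<bar>y $ k\<bar> \<le> B k"
    by metis
  have "bounded S"
  proof (rule boundedI)
    fix y assume "y \<in> S"
    then show "norm y \<le> (\<Sum>k\<in>UNIV. B k)"
      by (intro order_trans[OF norm_le_l1_cart] sum_mono B)
  qed
  moreover have "closed S"
    unfolding S_def by (intro closed_Collect_le cont continuous_on_const)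
  ultimately have "compact S"
    by (simp add: compact_eq_bounded_closed)
  moreover have "0 \<in> S"
    by (simp add: S_def)
  ultimately obtain y where "y \<in> S" "\<And>z. z \<in> S \<Longrightarrow> g y \<le> g z"
    using continuous_attains_inf[of S g] cont continuous_on_subset by blast
  \<comment> \<open>Outside \<open>S\<close> the value exceeds \<open>g 0\<close>, which is at least
    \<open>g y\<close>, so the minimum over \<open>S\<close> is global.\<close>
  then have min: "g y \<le> g z" for z
    unfolding S_def by (smt (verit) mem_Collect_eq)
  define X where "X k t = mexp (pencil A P (y + t *\<^sub>R axis k 1))" for k t
  have "tr_inner (A k) (mexp (pencil A P y)) = b $ k" for k
  proof -
    \<comment> \<open>This is the derivative of \<open>g\<close> at
      \<open>y + t *\<^sub>R axis k 1\<close> in direction \<open>k\<close>; only its sign is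
      needed.\<close>
    define f where "f t = tr_inner (A k) (X k t) - b $ k" for t
    have "continuous_on UNIV f"
      unfolding f_def X_def
      by (intro continuous_intros continuous_on_compose2[OF cont_mexp]) auto
    then have "isCont f 0"
      by (simp add: continuous_on_eq_continuous_at)
    \<comment> \<open>Klein's inequality for \<open>X k t\<close> against
      \<open>pencil A P y\<close>, the entropy identity for \<open>X k t\<close> and minimality of
      \<open>y\<close> are combined; the pairings with \<open>pencil A P y\<close> cancel.\<close>
    moreover have "0 \<le> t * f t" for t
    proof -
      have "vn_entropy (X k t) =
          trace (X k t) - tr_inner (pencil A P y) (X k t) - t * tr_inner (A k) (X k t)"
        unfolding X_def by (subst vn_entropy_mexp[OF sym]) (simp add: pencil_add_axis tr_inner_linear_left)
      moreover have "vn_entropy (X k t) \<le> trace (mexp (pencil A P y)) - tr_inner (pencil A P y) (X k t)"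
        unfolding X_def by (intro klein_inequality mexp_psd_cone sym)
      moreover have "trace (mexp (pencil A P y)) \<le> trace (X k t) - t * b $ k"
        using min[of "y + t *\<^sub>R axis k 1"]
        by (simp add: g_def X_def inner_add_right inner_axis)
      ultimately show ?thesis
        by (simp add: f_def right_diff_distrib)
    qed
    ultimately have "f 0 = 0"
      by (rule continuous_eq_0_if_sign)
    then show ?thesis
      by (simp add: f_def X_def)
  qed
  then have "mexp (pencil A P y) \<in> spectrahedron A b"
    by (simp add: spectrahedron_def mexp_psd_cone[OF sym] proj_def vec_eq_iff)
  then show thesis by (rule that)
qed

section \<open>Uniqueness and optimality of Gibbs points\<close>

lemma shifted_span_sym_mats:
  assumes "\<And>k. A k \<in> sym_mats" "C \<in> sym_mats"
  shows "shifted_span A C \<epsilon> \<subseteq> sym_mats"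
proof -
  have "span (range A) \<subseteq> sym_mats"
    using assms by (intro span_minimal subspace_sym_mats) auto
  then show ?thesis
    using assms subspace_sym_mats unfolding shifted_span_def
    by (auto intro!: subspace_diff subspace_scale)
qed

text \<open>Pairings with the \<open>A k\<close> are the coordinates of \<open>b\<close>, and
  linearity extends this to the span. The span part of a Gibbs exponent thus cancels when feasible
  points are compared.\<close>

lemma tr_inner_span_spectrahedron:
  assumes "M \<in> span (range A)" "X \<in> spectrahedron A b" "Y \<in> spectrahedron A b"
  shows "tr_inner M X = tr_inner M Y"
  using assms(1)
proof (induction rule: span_induct)
  case base
  show ?case
    by (auto simp: subspace_def tr_inner_linear_left)
next
  case (step M)
  then obtain k where "M = A k" by blast
  moreover have "proj A X $ k = proj A Y $ k"
    using assms by (simp add: spectrahedron_def)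
  ultimately show ?case
    by (simp add: proj_def)
qed

text \<open>Klein's inequality for the exponent of \<open>Z\<close> is strict at \<open>Y\<close>
  and an equality at \<open>Z\<close>. The objective is divided by \<open>\<epsilon>\<close>, so
  that \<open>c = 0\<close> covers the infinite case.\<close>

lemma gibbs_point_strict_optimum:
  fixes A :: "'d::finite \<Rightarrow> real^'n^'n"
  assumes A: "\<And>k. A k \<in> sym_mats" and C: "C \<in> sym_mats"
    and Z: "Z \<in> spectrahedron A b" "Z \<in> gibbs_manifold (shifted_span A C \<epsilon>)"
    and Y: "Y \<in> spectrahedron A b" "Y \<noteq> Z"
  defines "c \<equiv> real_of_ereal (1 / \<epsilon>)"
  shows "c * tr_inner C Z - vn_entropy Z < c * tr_inner C Y - vn_entropy Y"
proof -
  obtain N where N: "N \<in> shifted_span A C \<epsilon>" "Z = mexp N"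
    using Z(2) by (auto simp: gibbs_manifold_def)
  then obtain M where M: "M \<in> span (range A)" "N = M - c *\<^sub>R C"
    by (auto simp: shifted_span_def c_def)
  have sym: "N \<in> sym_mats"
    using N(1) shifted_span_sym_mats[of A C \<epsilon>] A C by blast
  have "Y \<in> psd_cone"
    using Y by (simp add: spectrahedron_def)
  then have "vn_entropy Y < trace Z - tr_inner N Y"
    using klein_inequality[of Y N] sym Y(2) N(2) by force
  moreover have "vn_entropy Z = trace Z - tr_inner N Z"
    using vn_entropy_mexp[OF sym] N(2) by simp
  ultimately show ?thesis
    using tr_inner_span_spectrahedron[OF M(1) Z(1) Y(1)] by (simp add: M(2) tr_inner_linear_left)
qed

text \<open>The condition on \<open>b\<close> is membership in the interior because Gibbs points are
  positive definite and, for independent \<open>A k\<close>, project to interior points. Each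
  equivalence with \<open>Y = Xs\<close> gives optimality and uniqueness together.\<close>

theorem theorem5p1:
  fixes A :: "'d::finite \<Rightarrow> real^'n^'n" and C :: "real^'n^'n"
    and b :: "real^'d" and \<epsilon> :: ereal
  assumes "\<And>k. A k \<in> sym_mats"
    and "inj A" and "independent (range A)"
    and "C \<in> sym_mats"
    and "0 < \<epsilon>"
    and "b \<in> interior (proj A ` psd_cone)"
  shows "\<exists>Xs.
      spectrahedron A b \<inter> gibbs_manifold (shifted_span A C \<epsilon>) = {Xs} \<and>
      (\<epsilon> \<noteq> \<infinity> \<longrightarrow>
        (\<forall>Y. is_arg_min (\<lambda>X. tr_inner C X - real_of_ereal \<epsilon> * vn_entropy X)
                        (\<lambda>X. X \<in> spectrahedron A b) Y \<longleftrightarrow> Y = Xs)) \<and>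
      (\<epsilon> = \<infinity> \<longrightarrow>
        (\<forall>Y. is_arg_max vn_entropy (\<lambda>X. X \<in> spectrahedron A b) Y \<longleftrightarrow> Y = Xs))"
proof -
  define c where "c = real_of_ereal (1 / \<epsilon>)"
  define F where "F X = c * tr_inner C X - vn_entropy X" for X
  let ?G = "gibbs_manifold (shifted_span A C \<epsilon>)"
  \<comment> \<open>With this offset the pencil runs through the shifted span.\<close>
  have "- c *\<^sub>R C \<in> sym_mats"
    using assms(4) subspace_sym_mats subspace_scale by blast
  then obtain y where y: "mexp (pencil A (- c *\<^sub>R C) y) \<in> spectrahedron A b"
    using mexp_pencil_meets_spectrahedron assms(1,6) by blast
  define Z where "Z = mexp (pencil A (- c *\<^sub>R C) y)"
  have "(\<Sum>k\<in>UNIV. y $ k *\<^sub>R A k) \<in> span (range A)"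
    by (intro span_sum span_scale span_base) auto
  then have Z: "Z \<in> spectrahedron A b" "Z \<in> ?G"
    using y by (auto simp: Z_def gibbs_manifold_def shifted_span_def pencil_def c_def)
  have strict: "F X < F Y"
    if "X \<in> spectrahedron A b" "X \<in> ?G" "Y \<in> spectrahedron A b" "Y \<noteq> X" for X Y
    unfolding F_def c_def
    using gibbs_point_strict_optimum[OF assms(1,4) that] .
  \<comment> \<open>Two distinct Gibbs points would each have a strictly smaller value of
    \<open>F\<close> than the other.\<close>
  have single: "spectrahedron A b \<inter> ?G = {Z}"
    using strict[OF Z] strict[OF _ _ Z(1)] Z by (blast dest: less_asym)
  have argmin: "is_arg_min F (\<lambda>X. X \<in> spectrahedron A b) Y \<longleftrightarrow> Y = Z" for Y
    using strict[OF Z] Z(1) unfolding is_arg_min_def by (metis less_asym)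
  have "is_arg_min (\<lambda>X. tr_inner C X - real_of_ereal \<epsilon> * vn_entropy X)
      (\<lambda>X. X \<in> spectrahedron A b) Y \<longleftrightarrow> Y = Z" if finite: "\<epsilon> \<noteq> \<infinity>" for Y
  proof -
    obtain e where e: "\<epsilon> = ereal e" "0 < e"
      using finite assms(5) by (cases \<epsilon>) auto
    \<comment> \<open>Scaling by \<open>e > 0\<close> keeps the minimisers.\<close>
    then have "tr_inner C X - real_of_ereal \<epsilon> * vn_entropy X = e * F X" for X
      by (simp add: F_def c_def one_ereal_def field_simps)
    then show ?thesis
      using argmin[of Y] e(2) by (simp add: is_arg_min_def)
  qed
  moreover have "is_arg_max vn_entropy (\<lambda>X. X \<in> spectrahedron A b) Y \<longleftrightarrow> Y = Z"
    if "\<epsilon> = \<infinity>" for Y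
  proof -
    \<comment> \<open>Here \<open>c = 0\<close>, so minimising \<open>F\<close> is maximising the
      entropy.\<close>
    have "F X = - vn_entropy X" for X
      using that by (simp add: F_def c_def)
    then show ?thesis
      using argmin[of Y] by (simp add: is_arg_min_def is_arg_max_def)
  qed
  ultimately show ?thesis
    using single by blast
qed

end
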